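(* (a) If a nonsingular dynamical system is W-measurably sensitive, then it is measurably sensitive. (b) If a nonsingular dynamical system is conservative, ergodic and measurably sensitive, then it is W-measurably sensitive.
   Context: A nonsingular dynamical system is a quadruple $(X,\mathcal S(X),\mu,T)$ (also written $(X,\mu,T)$) where $(X,\mathcal S(X))$ is a standard Borel space, $\mu$ is a nonzero $\sigma$-finite nonatomic measure on $\mathcal S(X)$, and $T:X\to X$ is measurable with $\mu(A)=0$ if and only if $\mu(T^{-1}(A))=0$ for all $A\in\mathcal S(X)$. $T$ is conservative and ergodic if and only if for every measurable $A$ with $T^{-1}(A)\subset A$ one has $\mu(A)=0$ or $\mu(A^c)=0$. All metrics $d:X\times X\to\mathbb R$ are assumed Borel measurable and bounded by $1$. Such a metric $d$ is $\mu$-compatible if every ball $B^d(x,\varepsilon)=\{y: d(x,y)<\varepsilon\}$ ($x\in X$, $\varepsilon>0$) has positive $\mu$-measure. For a $\mu$-compatible metric $d$, the system is W-measurably sensitive with respect to $d$ if there is $\delta>0$ such that for every $x\in X$, $\limsup_{n\to\infty} d(T^nx,T^ny)>\delta$ for $\mu$-almost every $y\in X$. The system is W-measurably sensitive if this holds for every $\mu$-compatible metric $d$ on $X$. Isomorphism mod $0$ of $(X,\mu,T)$ and $(X',\mu',T')$: there are Borel sets $U\subset X$, $U'\subset X'$ with $\mu(X\setminus U)=\mu'(X'\setminus U')=0$, $T(U)\subset U$, $T'(U')\subset U'$, and a measure-preserving (bimeasurable) bijection $\phi:U\to U'$ with $\phi\circ T=T'\circ\phi$ on $U$. The system $(X,\mu,T)$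 is measurably sensitive if for every nonsingular dynamical system $(X_1,\mathcal S(X_1),\mu_1,T_1)$ isomorphic mod $0$ to it and every $\mu_1$-compatible metric $d$ on $X_1$ there exists $\delta>0$ such that for all $x\in X_1$ and all $\varepsilon>0$ there exists $n\in\mathbb N$ with $\mu_1\{y\in B^d(x,\varepsilon): d(T_1^n x,T_1^n y)>\delta\}>0$. *)

theory Defs
  imports "HOL-Analysis.Analysis"
begin

definition standard_borel_space :: "'a measure \<Rightarrow> bool" where
  "standard_borel_space M \<longleftrightarrow>
     (\<exists>X. completely_metrizable_space X \<and> second_countable X \<and>
          topspace X = space M \<and> sets M = sigma_sets (space M) {U. openin X U})"

definition nonatomic_measure :: "'a measure \<Rightarrow> bool" where
  "nonatomic_measure M \<longleftrightarrow>
     (\<forall>A\<in>sets M. 0 < emeasure M A \<longrightarrow>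
        (\<exists>B\<in>sets M. B \<subseteq> A \<and> 0 < emeasure M B \<and> emeasure M B < emeasure M A))"

text \<open>The phase space is \<^term>\<open>space M\<close>; the values of \<open>T\<close> outside it play no role.\<close>

locale nonsingular_system = sigma_finite_measure M
  for M :: "'a measure" and T :: "'a \<Rightarrow> 'a" +
  assumes standard_borel: "standard_borel_space M"
    and nonzero: "emeasure M (space M) \<noteq> 0"
    and nonatomic: "nonatomic_measure M"
    and measurable_T: "T \<in> measurable M M"
    and nonsingular: "\<And>A. A \<in> sets M \<Longrightarrow>
          emeasure M A = 0 \<longleftrightarrow> emeasure M (T -` A \<inter> space M) = 0"

text \<open>Conservativity and ergodicity together, expressed by sets \<open>A\<close> with
  \<open>T\<close>-preimage contained in \<open>A\<close>.\<close>

definition conservative_ergodic :: "'a measure \<Rightarrow> ('a \<Rightarrow> 'a) \<Rightarrow> bool" where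
  "conservative_ergodic M T \<longleftrightarrow>
     (\<forall>A\<in>sets M. T -` A \<inter> space M \<subseteq> A \<longrightarrow>
        emeasure M A = 0 \<or> emeasure M (space M - A) = 0)"

definition dball :: "'a measure \<Rightarrow> ('a \<Rightarrow> 'a \<Rightarrow> real) \<Rightarrow> 'a \<Rightarrow> real \<Rightarrow> 'a set" where
  "dball M d x \<epsilon> = {y \<in> space M. d x y < \<epsilon>}"

text \<open>The locale \<^locale>\<open>Metric_space\<close> also asks for symmetry and nonnegativity of \<open>d\<close>
  outside the carrier. This is harmless: a metric on \<^term>\<open>space M\<close> can be extended by \<open>0\<close>.\<close>

definition compatible_metric :: "'a measure \<Rightarrow> ('a \<Rightarrow> 'a \<Rightarrow> real) \<Rightarrow> bool" where
  "compatible_metric M d \<longleftrightarrow>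
     Metric_space (space M) d \<and>
     (\<forall>x\<in>space M. \<forall>y\<in>space M. d x y \<le> 1) \<and>
     (\<lambda>(x, y). d x y) \<in> borel_measurable (M \<Otimes>\<^sub>M M) \<and>
     (\<forall>x\<in>space M. \<forall>\<epsilon>>0. 0 < emeasure M (dball M d x \<epsilon>))"

definition W_sensitive_wrt ::
  "'a measure \<Rightarrow> ('a \<Rightarrow> 'a) \<Rightarrow> ('a \<Rightarrow> 'a \<Rightarrow> real) \<Rightarrow> bool" where
  "W_sensitive_wrt M T d \<longleftrightarrow>
     (\<exists>\<delta>>0. \<forall>x\<in>space M. AE y in M.
        limsup (\<lambda>n. ereal (d ((T ^^ n) x) ((T ^^ n) y))) > ereal \<delta>)"

definition W_measurably_sensitive :: "'a measure \<Rightarrow> ('a \<Rightarrow> 'a) \<Rightarrow> bool" where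
  "W_measurably_sensitive M T \<longleftrightarrow> (\<forall>d. compatible_metric M d \<longrightarrow> W_sensitive_wrt M T d)"

definition isomorphic_mod0 ::
  "'a measure \<Rightarrow> ('a \<Rightarrow> 'a) \<Rightarrow> 'b measure \<Rightarrow> ('b \<Rightarrow> 'b) \<Rightarrow> bool" where
  "isomorphic_mod0 M T M' T' \<longleftrightarrow>
     (\<exists>U\<in>sets M. \<exists>U'\<in>sets M'. \<exists>\<phi>.
        emeasure M (space M - U) = 0 \<and> emeasure M' (space M' - U') = 0 \<and>
        T ` U \<subseteq> U \<and> T' ` U' \<subseteq> U' \<and>
        bij_betw \<phi> U U' \<and>
        \<phi> \<in> measurable (restrict_space M U) (restrict_space M' U') \<and>
        the_inv_into U \<phi> \<in> measurable (restrict_space M' U') (restrict_space M U) \<and>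
        (\<forall>A\<in>sets M. A \<subseteq> U \<longrightarrow> emeasure M' (\<phi> ` A) = emeasure M A) \<and>
        (\<forall>x\<in>U. \<phi> (T x) = T' (\<phi> x)))"

text \<open>HOL cannot quantify over types inside a formula, so the type \<open>'b\<close> carrying the isomorphic
  systems is a parameter. For every \<open>'b\<close> into which the real line injects nothing is lost: a
  standard Borel space has at most continuum many points, so it has a copy whose carrier is a
  subset of \<open>'b\<close>. In particular \<open>'b = 'a\<close> is enough when \<open>(M, T)\<close> is a nonsingular system,
  because a nonatomic nonzero measure on a standard Borel space lives on a set of cardinality
  continuum.\<close>

definition measurably_sensitive ::
  "'b itself \<Rightarrow> 'a measure \<Rightarrow> ('a \<Rightarrow> 'a) \<Rightarrow> bool" where
  "measurably_sensitive _ M T \<longleftrightarrow>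
     (\<forall>(M1 :: 'b measure) T1 d.
        nonsingular_system M1 T1 \<and> isomorphic_mod0 M T M1 T1 \<and> compatible_metric M1 d \<longrightarrow>
        (\<exists>\<delta>>0. \<forall>x\<in>space M1. \<forall>\<epsilon>>0. \<exists>n.
           0 < emeasure M1 {y \<in> dball M1 d x \<epsilon>. d ((T1 ^^ n) x) ((T1 ^^ n) y) > \<delta>}))"

end

theory Submission
  imports Defs
begin

text \<open>Both implications transfer a metric from an invariant conull set \<open>U\<close> to all of \<open>X\<close>. The
  discarded null set may be uncountable, so it is embedded into a Cantor set in the completion of
  \<open>(U, d)\<close>: a scheme of shrinking \<open>d\<close>-balls whose limit set, a null set, is removed from \<open>U\<close>. Since
  balls have positive measure, the extended metric is again compatible.

  For (a), the metric of an isomorphic system is pulled back to \<open>X\<close> and extended. If measurable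
  sensitivity fails at \<open>x\<close> with constant \<open>\<delta> / 2\<close>, almost all pairs in some ball around \<open>x\<close> stay
  \<open>\<delta>\<close>-close along their orbits, although \<open>x\<close> itself may be lost in the transfer.

  For (b), let \<open>d\<close> violate W-measurable sensitivity and put \<open>D x y = sup\<^sub>n d (T\<^sup>n x) (T\<^sup>n y)\<close>. The set
  of points all of whose \<open>D\<close>-balls have positive measure is forward invariant, and the violation
  together with ergodicity makes it conull. On it \<open>T\<close> is 1-Lipschitz for \<open>D\<close>, and the extension
  of \<open>D\<close> to \<open>X\<close> contradicts measurable sensitivity.\<close>

section \<open>Cantor schemes in a metric space with null points and positive balls\<close>

text \<open>Finiteness of \<open>N\<close> gives continuity from above along shrinking balls. In
  \<open>extend_metric\<close>, \<open>N\<close> is a finite measure with the same null sets as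
  \<open>M\<close>.\<close>

locale measured_metric = finite_measure N + Metric_space U d
  for N :: "'a measure" and U :: "'a set" and d :: "'a \<Rightarrow> 'a \<Rightarrow> real" +
  assumes carrier_sets: "U \<in> sets N"
    and carrier_nonempty: "U \<noteq> {}"
    and measurable_metric: "(\<lambda>(x, y). d x y) \<in> borel_measurable (N \<Otimes>\<^sub>M N)"
    and point_null: "\<And>x. x \<in> U \<Longrightarrow> emeasure N {x} = 0"
    and ball_positive: "\<And>x e. x \<in> U \<Longrightarrow> 0 < e \<Longrightarrow> 0 < emeasure N {y \<in> U. d x y < e}"
begin

lemma measurable_dist_from:
  assumes "x \<in> U"
  shows "d x \<in> borel_measurable N"
proof -
  have "x \<in> space N"
    using assms carrier_sets sets.sets_into_space by blast
  then have "(\<lambda>y. (x, y)) \<in> N \<rightarrow>\<^sub>M N \<Otimes>\<^sub>M N"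
    by simp
  from measurable_compose[OF this measurable_metric] show ?thesis
    by simp
qed

lemma mcball_sets: "x \<in> U \<Longrightarrow> mcball x r \<in> sets N"
proof -
  assume x: "x \<in> U"
  note [measurable] = measurable_dist_from[OF x] carrier_sets
  have "mcball x r = {y \<in> space N. d x y \<le> r} \<inter> U"
    using x sets.sets_into_space[OF carrier_sets] by (auto simp: in_mcball)
  also have "\<dots> \<in> sets N"
    by measurable
  finally show ?thesis .
qed

lemma measure_mcball_tendsto:
  assumes "x \<in> U"
  shows "(\<lambda>n. measure N (mcball x (1 / Suc n))) \<longlonglongrightarrow> 0"
proof -
  have "(\<lambda>n. measure N (mcball x (1 / Suc n))) \<longlonglongrightarrow> measure N (\<Inter>n. mcball x (1 / Suc n))"
  proof (rule finite_Lim_measure_decseq)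
    show "range (\<lambda>n. mcball x (1 / real (Suc n))) \<subseteq> sets N"
      using mcball_sets[OF assms] by blast
    show "decseq (\<lambda>n. mcball x (1 / real (Suc n)))"
      unfolding decseq_def by (intro allI impI mcball_subset_concentric) (simp add: frac_le)
  qed
  also have "(\<Inter>n. mcball x (1 / Suc n)) = {x}"
  proof
    show "{x} \<subseteq> (\<Inter>n. mcball x (1 / Suc n))"
      using assms by (auto simp: in_mcball)
    show "(\<Inter>n. mcball x (1 / Suc n)) \<subseteq> {x}"
    proof
      fix y assume y: "y \<in> (\<Inter>n. mcball x (1 / Suc n))"
      then have "y \<in> U" and le: "\<And>n. d x y \<le> 1 / Suc n"
        by (auto simp: in_mcball)
      have "d x y \<le> 0"
        using le by (intro LIMSEQ_le_const[OF LIMSEQ_inverse_real_of_nat]) (auto simp: inverse_eq_divide)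
      then have "d x y = 0"
        by (simp add: antisym)
      with assms \<open>y \<in> U\<close> show "y \<in> {x}"
        by simp
    qed
  qed
  also have "measure N {x} = 0"
    using point_null[OF assms] by (simp add: measure_def)
  finally show ?thesis .
qed

text \<open>Closed balls of radius tending to 0 decrease to the null set \<open>{x}\<close>. The
  bound covers all \<open>t \<le> s\<close>, so that the radius can still be shrunk to meet further
  constraints.\<close>

lemma small_mcball:
  assumes "x \<in> U" "0 < \<eta>"
  obtains s where "0 < s" "\<And>t. t \<le> s \<Longrightarrow> measure N (mcball x t) \<le> \<eta>"
proof -
  have "eventually (\<lambda>n. measure N (mcball x (1 / Suc n)) < \<eta>) sequentially"
    using measure_mcball_tendsto[OF assms(1)] assms(2) by (rule order_tendstoD(2))
  then obtain n where n: "measure N (mcball x (1 / Suc n)) < \<eta>"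
    by (auto simp: eventually_sequentially)
  show ?thesis
  proof
    show "0 < 1 / real (Suc n)"
      by simp
    fix t assume "t \<le> 1 / real (Suc n)"
    then have "measure N (mcball x t) \<le> measure N (mcball x (1 / Suc n))"
      using assms(1) by (intro finite_measure_mono mcball_subset_concentric mcball_sets)
    with n show "measure N (mcball x t) \<le> \<eta>"
      by linarith
  qed
qed

text \<open>The point \<open>p\<close> is null but the ball of radius \<open>r / 2\<close> around it
  is not, so it contains a second point \<open>q\<close>. The bounds by \<open>r\<close> keep both
  new balls inside the old one; \<open>4 * s \<le> d p q\<close> keeps points of the two new balls
  at distance at least \<open>2 * s\<close>.\<close>

lemma split_ball:
  assumes p: "p \<in> U" and r: "0 < r" and \<eta>: "0 < \<eta>"
  shows "\<exists>q s. q \<in> U \<and> 0 < s \<and> s \<le> r / 4 \<and> d p q \<le> r / 2 \<and> 4 * s \<le> d p q \<and>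
    measure N (mcball p s) \<le> \<eta> \<and> measure N (mcball q s) \<le> \<eta>"
proof -
  have "\<not> {y \<in> U. d p y < r / 2} \<subseteq> {p}"
  proof
    assume sub: "{y \<in> U. d p y < r / 2} \<subseteq> {p}"
    have "p \<in> {y \<in> U. d p y < r / 2}"
      using p r by simp
    with sub have "{y \<in> U. d p y < r / 2} = {p}"
      by blast
    with ball_positive[OF p, of "r / 2"] point_null[OF p] r show False
      by simp
  qed
  then obtain q where q: "q \<in> U" "d p q < r / 2" "q \<noteq> p"
    by blast
  have pos: "0 < d p q"
    using p q by (simp add: order_less_le)
  obtain s1 where s1: "0 < s1" "\<And>t. t \<le> s1 \<Longrightarrow> measure N (mcball p t) \<le> \<eta>"
    using small_mcball[OF p \<eta>] by blast
  obtain s2 where s2: "0 < s2" "\<And>t. t \<le> s2 \<Longrightarrow> measure N (mcball q t) \<le> \<eta>"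
    using small_mcball[OF q(1) \<eta>] by blast
  define s where "s = min (min s1 s2) (min (r / 4) (d p q / 4))"
  have "0 < s" "s \<le> s1" "s \<le> s2" "s \<le> r / 4" "4 * s \<le> d p q"
    using s1(1) s2(1) pos r by (auto simp: s_def)
  with q s1(2) s2(2) show ?thesis
    by (intro exI[of _ q] exI[of _ s]) auto
qed

text \<open>A Cantor scheme of balls \<open>mcball (p s) (r s)\<close>; the head of \<open>s\<close> is the most recent choice.\<close>

lemma ball_scheme:
  obtains p :: "bool list \<Rightarrow> 'a" and r :: "bool list \<Rightarrow> real"
  where "\<And>s. p s \<in> U" "\<And>s. 0 < r s" "r [] = 1"
    "\<And>b s. r (b # s) \<le> r s / 4"
    "\<And>b s. d (p s) (p (b # s)) \<le> r s / 2"
    "\<And>s. r (True # s) = r (False # s)"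
    "\<And>s. 4 * r (True # s) \<le> d (p (True # s)) (p (False # s))"
    "\<And>b s. measure N (mcball (p (b # s)) (r (b # s))) \<le> (1 / 4) ^ length s"
proof -
  \<comment> \<open>The depth \<open>n\<close> of the scheme determines the measure bound. The point
    \<open>Q\<close> is chosen first, among those admitting some radius, and \<open>R\<close> is
    then a radius for this \<open>Q\<close>.\<close>
  define G where "G p r n q s \<longleftrightarrow> q \<in> U \<and> 0 < s \<and> s \<le> r / 4 \<and> d p q \<le> r / 2 \<and> 4 * s \<le> d p q \<and>
      measure N (mcball p s) \<le> (1 / 4) ^ n \<and> measure N (mcball q s) \<le> (1 / 4) ^ n"
    for p r q s and n :: nat
  define Q where "Q p r n = (SOME q. \<exists>s. G p r n q s)" for p r n
  define R where "R p r n = (SOME s. G p r n (Q p r n) s)" for p r n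
  have QR: "G p r n (Q p r n) (R p r n)" if "p \<in> U" "0 < r" for p r n
  proof -
    have "\<exists>q s. G p r n q s"
      unfolding G_def by (rule split_ball) (use that in auto)
    then show ?thesis
      unfolding Q_def R_def by (metis (mono_tags) someI_ex)
  qed
  obtain p0 where p0: "p0 \<in> U"
    using carrier_nonempty by blast
  \<comment> \<open>The branch \<open>False\<close> keeps the centre and \<open>True\<close> moves
    to the new point. Both children get the same radius.\<close>
  define F where "F = rec_list (p0, 1 :: real)
    (\<lambda>b s (p, r). (if b then Q p r (length s) else p, R p r (length s)))"
  define p where "p = fst \<circ> F"
  define r where "r = snd \<circ> F"
  have p_simps: "p [] = p0" "p (True # s) = Q (p s) (r s) (length s)" "p (False # s) = p s" for s
    by (simp_all add: p_def r_def F_def split_beta)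
  have r_simps: "r [] = 1" "r (b # s) = R (p s) (r s) (length s)" for b s
    by (simp_all add: p_def r_def F_def split_beta)
  have inv: "p s \<in> U \<and> 0 < r s" for s
  proof (induction s)
    case (Cons b s)
    then show ?case
      using QR[of "p s" "r s" "length s"] unfolding G_def by (cases b) (auto simp: p_simps r_simps)
  qed (simp add: p_simps r_simps p0)
  have step: "G (p s) (r s) n (Q (p s) (r s) n) (R (p s) (r s) n)" for s n
    using inv by (intro QR) auto
  note step = step[unfolded G_def]
  show ?thesis
  proof (rule that[of p r])
    fix s b
    show "p s \<in> U" "0 < r s" "r [] = 1" "r (b # s) \<le> r s / 4" "r (True # s) = r (False # s)"
      using inv step by (auto simp: r_simps)
    show "d (p s) (p (b # s)) \<le> r s / 2"
      using inv[of s] step[of s] by (cases b) (auto simp: p_simps)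
    show "4 * r (True # s) \<le> d (p (True # s)) (p (False # s))"
      using step[of s "length s"] by (simp add: p_simps r_simps commute[of "Q (p s) (r s) (length s)"])
    show "measure N (mcball (p (b # s)) (r (b # s))) \<le> (1 / 4) ^ length s"
      using step[of s] by (cases b) (auto simp: p_simps r_simps)
  qed
qed

text \<open>The sequences of centres along the branches of the scheme are uniformly Cauchy; they stand
  for the points of a Cantor set in the completion of \<open>U\<close>, of which \<open>K\<close> contains the part in \<open>U\<close>.\<close>

lemma cantor_sequences:
  obtains a :: "(nat \<Rightarrow> bool) \<Rightarrow> nat \<Rightarrow> 'a" and c :: "bool list \<Rightarrow> 'a" and K
  where "\<And>h n. a h n = c (map h [0..<n])" "\<And>s. c s \<in> U"
    "\<And>h m n. n \<le> m \<Longrightarrow> d (a h n) (a h m) \<le> (1 / 4) ^ n"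
    "\<And>h h'. h \<noteq> h' \<Longrightarrow> \<exists>e>0. \<exists>n. \<forall>m\<ge>n. e \<le> d (a h m) (a h' m)"
    "K \<in> sets N" "emeasure N K = 0"
    "\<And>h x. x \<in> U \<Longrightarrow> (\<lambda>n. d (a h n) x) \<longlonglongrightarrow> 0 \<Longrightarrow> x \<in> K"
proof -
  obtain p :: "bool list \<Rightarrow> 'a" and r :: "bool list \<Rightarrow> real"
    where p: "\<And>s. p s \<in> U" and r0: "\<And>s. 0 < r s" and r1: "r [] = 1"
      and r_step: "\<And>b s. r (b # s) \<le> r s / 4"
      and p_step: "\<And>b s. d (p s) (p (b # s)) \<le> r s / 2"
      and r_eq: "\<And>s. r (True # s) = r (False # s)"
      and sep: "\<And>s. 4 * r (True # s) \<le> d (p (True # s)) (p (False # s))"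
      and small: "\<And>b s. measure N (mcball (p (b # s)) (r (b # s))) \<le> (1 / 4) ^ length s"
    using ball_scheme by blast
  \<comment> \<open>The reversal is needed because the scheme adds each new choice at the
    head.\<close>
  define w where "w h n = rev (map h [0..<n])" for h :: "nat \<Rightarrow> bool" and n
  have w_Suc: "w h (Suc n) = h n # w h n" for h n
    by (simp add: w_def)
  define a where "a h n = p (w h n)" for h n
  have aU: "a h n \<in> U" for h n
    by (simp add: a_def p)
  \<comment> \<open>Carrying the radius along makes the induction work: one step costs at most half
    the current radius, and the next radius is at most a quarter of it.\<close>
  have nest: "d (a h n) (a h m) + r (w h m) \<le> r (w h n)" if "n \<le> m" for h n m
    using that
  proof (induction m rule: dec_induct)
    case (step m)
    have "d (a h n) (a h (Suc m)) \<le> d (a h n) (a h m) + d (a h m) (a h (Suc m))"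
      by (intro triangle aU)
    moreover have "d (a h m) (a h (Suc m)) \<le> r (w h m) / 2"
      using p_step by (simp add: a_def w_Suc)
    moreover have "r (w h (Suc m)) \<le> r (w h m) / 4"
      using r_step by (simp add: w_Suc)
    ultimately show ?case
      using step.IH r0[of "w h m"] by linarith
  qed (simp add: aU)
  have close: "d (a h n) (a h m) \<le> r (w h n)" if "n \<le> m" for h n m
    using nest[OF that] r0[of "w h m"] by (smt (verit))
  have r_le: "r (w h n) \<le> (1 / 4) ^ n" for h n
  proof (induction n)
    case (Suc n)
    then show ?case
      using r_step[of "h n" "w h n"] by (simp add: w_Suc)
  qed (simp add: w_def r1)
  have apart: "\<exists>e>0. \<exists>n. \<forall>m\<ge>n. e \<le> d (a h m) (a h' m)" if "h \<noteq> h'" for h h'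
  proof -
    \<comment> \<open>At the first disagreement the branches enter the two children of a common node
      \<open>s\<close>, whose centres are \<open>4 * \<rho>\<close> apart. Each branch later moves
      by at most \<open>\<rho>\<close>, which leaves \<open>2 * \<rho>\<close>.\<close>
    define n where "n = (LEAST n. h n \<noteq> h' n)"
    have neq: "h n \<noteq> h' n"
      using LeastI_ex[of "\<lambda>n. h n \<noteq> h' n"] that by (auto simp: n_def fun_eq_iff)
    have eq: "h i = h' i" if "i < n" for i
      using not_less_Least[of i "\<lambda>n. h n \<noteq> h' n"] that by (simp add: n_def)
    define s where "s = w h n"
    have w': "w h' n = s"
      using eq by (simp add: s_def w_def)
    define \<rho> where "\<rho> = r (True # s)"
    have \<rho>: "r (b # s) = \<rho>" for b
      using r_eq by (cases b) (simp_all add: \<rho>_def)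
    have d4: "4 * \<rho> \<le> d (a h (Suc n)) (a h' (Suc n))"
    proof (cases "h n")
      case True
      then show ?thesis
        using sep[of s] neq by (simp add: a_def w_Suc w' s_def[symmetric] \<rho>)
    next
      case False
      then show ?thesis
        using sep[of s] neq by (simp add: a_def w_Suc w' s_def[symmetric] \<rho> commute[of "p (False # s)"])
    qed
    have "2 * \<rho> \<le> d (a h m) (a h' m)" if "Suc n \<le> m" for m
    proof -
      have "d (a h (Suc n)) (a h m) \<le> \<rho>" "d (a h' (Suc n)) (a h' m) \<le> \<rho>"
        using close[OF that, of h] close[OF that, of h'] by (simp_all add: w_Suc w' s_def[symmetric] \<rho>)
      moreover have "d (a h (Suc n)) (a h' (Suc n)) \<le>
          d (a h (Suc n)) (a h m) + d (a h m) (a h' (Suc n))"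
        by (intro triangle aU)
      moreover have "d (a h m) (a h' (Suc n)) \<le> d (a h m) (a h' m) + d (a h' m) (a h' (Suc n))"
        by (intro triangle aU)
      ultimately show ?thesis
        using d4 by (simp add: commute)
    qed
    moreover have "0 < \<rho>"
      using r0 by (simp add: \<rho>_def)
    ultimately show ?thesis
      by (intro exI[of _ "2 * \<rho>"] conjI exI[of _ "Suc n"]) auto
  qed
  define W where "W n = {s :: bool list. length s = n}" for n
  have W: "finite (W n)" "card (W n) = 2 ^ n" for n
    using finite_lists_length_eq[of "UNIV :: bool set" n] card_lists_length_eq[of "UNIV :: bool set" n]
    by (simp_all add: W_def)
  define L where "L n = (\<Union>s\<in>W n. mcball (p s) (r s))" for n
  have L_sets: "L n \<in> sets N" for n
    unfolding L_def using W p by (intro sets.finite_UN mcball_sets)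
  \<comment> \<open>There are \<open>2 ^ Suc n\<close> balls at this level, each of measure at most
    \<open>(1 / 4) ^ n\<close>.\<close>
  have L_small: "measure N (L (Suc n)) \<le> 2 * (1 / 2) ^ n" for n
  proof -
    have "measure N (L (Suc n)) \<le> (\<Sum>s\<in>W (Suc n). measure N (mcball (p s) (r s)))"
      unfolding L_def using W p by (intro finite_measure_subadditive_finite) (auto intro: mcball_sets)
    also have "\<dots> \<le> (\<Sum>s\<in>W (Suc n). (1 / 4) ^ n)"
    proof (rule sum_mono)
      fix s assume "s \<in> W (Suc n)"
      then show "measure N (mcball (p s) (r s)) \<le> (1 / 4) ^ n"
        using small by (auto simp: W_def length_Suc_conv)
    qed
    also have "\<dots> = 2 * (1 / 2) ^ n"
      by (simp add: W power_mult_distrib[symmetric])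
    finally show ?thesis .
  qed
  define K where "K = (\<Inter>n. L n)"
  have K_sets: "K \<in> sets N"
    unfolding K_def using L_sets by blast
  have "measure N K \<le> 2 * (1 / 2) ^ n" for n
    using finite_measure_mono[of K "L (Suc n)"] L_sets L_small[of n] by (force simp: K_def)
  moreover have "(\<lambda>n. 2 * (1 / 2) ^ n :: real) \<longlonglongrightarrow> 0"
    by (intro tendsto_eq_intros LIMSEQ_power_zero) auto
  ultimately have "measure N K \<le> 0"
    using LIMSEQ_le_const by blast
  then have K_null: "emeasure N K = 0"
    by (simp add: emeasure_eq_measure measure_le_0_iff)
  have K_limit: "x \<in> K" if x: "x \<in> U" and lim: "(\<lambda>n. d (a h n) x) \<longlonglongrightarrow> 0" for h x
  proof -
    have "x \<in> L n" for n
    proof -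
      \<comment> \<open>All later centres lie within \<open>r (w h n)\<close> of
        \<open>a h n\<close>; the closed ball therefore also contains their limit.\<close>
      have "d (a h n) x \<le> r (w h n) + 0"
      proof (rule LIMSEQ_le_const[OF tendsto_add[OF tendsto_const lim]], intro exI[of _ n] allI impI)
        fix m assume "n \<le> m"
        then show "d (a h n) x \<le> r (w h n) + d (a h m) x"
          using close[of n m h] triangle[OF aU aU x, of h n h m] by linarith
      qed
      then have "x \<in> mcball (p (w h n)) (r (w h n))"
        using x p by (simp add: in_mcball a_def)
      moreover have "w h n \<in> W n"
        by (simp add: W_def w_def)
      ultimately show ?thesis
        unfolding L_def by blast
    qed
    then show ?thesis
      by (simp add: K_def)
  qed
  show ?thesis
  \<comment> \<open>Composing with \<open>rev\<close> lets \<open>c\<close> read prefixes in natural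
    order. That \<open>a h n\<close> depends only on a finite prefix is what later yields
    measurability in \<open>h\<close>.\<close>
  proof (rule that[of a "p \<circ> rev" K])
    show "d (a h n) (a h m) \<le> (1 / 4) ^ n" if "n \<le> m" for h n m
      using close[OF that, of h] r_le[of h n] by linarith
  qed (use apart K_sets K_null K_limit p in \<open>simp_all add: a_def w_def\<close>)
qed

end

section \<open>Separating sequences, null points and iterates of a nonsingular map\<close>

context nonsingular_system
begin

text \<open>Membership in the sets of a countable base separates points by the Hausdorff property.
  The resulting 0-1 sequences later serve as branch labels for the points outside a conull
  set.\<close>

lemma separating_sequence:
  obtains h :: "'a \<Rightarrow> nat \<Rightarrow> bool"
  where "\<And>i. (\<lambda>x. h x i) \<in> measurable M (count_space UNIV)" "inj_on h (space M)"
proof -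
  obtain X where X: "completely_metrizable_space X" "second_countable X" "topspace X = space M"
    and sets: "sets M = sigma_sets (space M) {U. openin X U}"
    using standard_borel by (auto simp: standard_borel_space_def)
  have haus: "Hausdorff_space X"
    using X(1) completely_metrizable_imp_metrizable_space metrizable_imp_Hausdorff_space by blast
  have open_sets: "V \<in> sets M" if "openin X V" for V
    unfolding sets using that by (auto intro: sigma_sets.Basic)
  obtain B where B: "countable B" "\<And>V. V \<in> B \<Longrightarrow> openin X V"
    "\<And>U x. openin X U \<Longrightarrow> x \<in> U \<Longrightarrow> \<exists>V\<in>B. x \<in> V \<and> V \<subseteq> U"
    using X(2) unfolding second_countable_def by metis
  \<comment> \<open>Adding the empty set ensures that there is something to enumerate, even without
    knowing that \<open>B\<close> is nonempty.\<close>
  define V where "V = from_nat_into (insert {} B)"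
  have V: "range V = insert {} B"
    unfolding V_def using B(1) by (intro range_from_nat_into) auto
  have V_open: "openin X (V i)" for i
    using V B(2) by (metis insertE openin_empty rangeI)
  show ?thesis
  proof (rule that[of "\<lambda>x i. x \<in> V i"])
    fix i
    show "(\<lambda>x. x \<in> V i) \<in> measurable M (count_space UNIV)"
      using open_sets[OF V_open] by measurable
  next
    show "inj_on (\<lambda>x i. x \<in> V i) (space M)"
    proof (rule inj_onI, rule ccontr)
      fix x y assume xy: "x \<in> space M" "y \<in> space M" "(\<lambda>i. x \<in> V i) = (\<lambda>i. y \<in> V i)" "x \<noteq> y"
      then obtain A A' where "openin X A" "openin X A'" "x \<in> A" "y \<in> A'" "disjnt A A'"
        using haus X(3) unfolding Hausdorff_space_def by metis
      then obtain W where "W \<in> B" "x \<in> W" "y \<notin> W"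
        using B(3)[of A x] by (auto simp: disjnt_iff)
      with V xy(3) show False
        by (metis insertCI rangeE)
    qed
  qed
qed

lemma singleton_sets:
  assumes "x \<in> space M"
  shows "{x} \<in> sets M"
proof -
  obtain h :: "'a \<Rightarrow> nat \<Rightarrow> bool"
    where [measurable]: "\<And>i. (\<lambda>x. h x i) \<in> measurable M (count_space UNIV)"
      and inj: "inj_on h (space M)"
    by (rule separating_sequence) (rule that)
  have "{y \<in> space M. \<forall>i. h y i = h x i} \<in> sets M"
    by measurable
  also have "{y \<in> space M. \<forall>i. h y i = h x i} = {x}"
    using assms inj by (auto simp: fun_eq_iff[symmetric] dest: inj_onD)
  finally show ?thesis .
qed

lemma emeasure_singleton:
  assumes "x \<in> space M"
  shows "emeasure M {x} = 0"
proof (rule ccontr)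
  assume "emeasure M {x} \<noteq> 0"
  moreover have "{x} \<in> sets M"
    using singleton_sets assms by blast
  ultimately obtain B where "B \<subseteq> {x}" "0 < emeasure M B" "emeasure M B < emeasure M {x}"
    using nonatomic unfolding nonatomic_measure_def by (metis not_gr_zero)
  then show False
    by (metis emeasure_empty order_less_irrefl subset_singletonD)
qed

lemma measurable_funpow: "T ^^ n \<in> measurable M M"
  using measurable_T by (rule measurable_compose_n)

lemma emeasure_vimage_funpow:
  assumes "A \<in> sets M"
  shows "emeasure M ((T ^^ n) -` A \<inter> space M) = 0 \<longleftrightarrow> emeasure M A = 0"
proof (induction n)
  case (Suc n)
  have "(T ^^ Suc n) -` A \<inter> space M = T -` ((T ^^ n) -` A \<inter> space M) \<inter> space M"
    using measurable_space[OF measurable_T] by (auto simp: funpow_swap1)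
  moreover have "(T ^^ n) -` A \<inter> space M \<in> sets M"
    using measurable_funpow assms by (rule measurable_sets)
  ultimately show ?case
    using nonsingular Suc by metis
qed (use assms sets.sets_into_space in \<open>simp add: Int_absorb2\<close>)

section \<open>Extension of a metric from an invariant conull set\<close>

text \<open>Each point outside \<open>U0\<close> is represented by the Cauchy sequence of centres
  along its own branch, and \<open>d'\<close> is the limit of \<open>d\<close> along
  representatives. Distinct branches have distinct limits, and no limit lies in \<open>U0\<close>
  because \<open>K\<close> has been removed.\<close>

lemma extend_metric:
  assumes U: "U \<in> sets M" "emeasure M (space M - U) = 0" "T ` U \<subseteq> U"
    and metric: "Metric_space U d"
    and bounded: "\<And>x y. x \<in> U \<Longrightarrow> y \<in> U \<Longrightarrow> d x y \<le> 1"
    and meas: "(\<lambda>(x, y). d x y) \<in> borel_measurable (M \<Otimes>\<^sub>M M)"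
    and balls: "\<And>x e. x \<in> U \<Longrightarrow> 0 < e \<Longrightarrow> 0 < emeasure M {y \<in> U. d x y < e}"
  obtains U0 d' where "U0 \<in> sets M" "U0 \<subseteq> U" "emeasure M (space M - U0) = 0" "T ` U0 \<subseteq> U0"
    "compatible_metric M d'" "\<And>x y. x \<in> U0 \<Longrightarrow> y \<in> U0 \<Longrightarrow> d' x y = d x y"
proof -
  obtain h :: "'a \<Rightarrow> nat \<Rightarrow> bool"
    where h_meas: "\<And>i. (\<lambda>x. h x i) \<in> measurable M (count_space UNIV)"
      and h_inj: "inj_on h (space M)"
    by (rule separating_sequence) (rule that)
  have U_space: "U \<subseteq> space M"
    using U(1) by (rule sets.sets_into_space)
  \<comment> \<open>By sigma-finiteness there is a positive integrable density; it yields a finite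
    measure with the null sets of \<open>M\<close>.\<close>
  obtain f :: "'a \<Rightarrow> real" where f: "f \<in> borel_measurable M" "\<And>x. f x > 0" "integrable M f"
    using obtain_positive_integrable_function by blast
  define N where "N = density M f"
  have sets_N: "sets N = sets M"
    by (simp add: N_def)
  have null_N: "emeasure N A = 0 \<longleftrightarrow> emeasure M A = 0" if "A \<in> sets M" for A
  proof -
    have "ennreal (f x) \<noteq> 0" for x
      using f(2)[of x] by (simp add: ennreal_eq_0_iff)
    then have "A \<in> null_sets N \<longleftrightarrow> (AE x in M. x \<notin> A)"
      unfolding N_def using f(1) that by (subst null_sets_density_iff) simp_all
    also have "\<dots> \<longleftrightarrow> A \<in> null_sets M"
      using that by (rule AE_iff_null_sets[symmetric])
    finally show ?thesis
      using that by (simp add: null_sets_def sets_N)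
  qed
  interpret d: Metric_space U d
    by (rule metric)
  interpret fin: finite_measure N
  proof (rule finite_measureI)
    have "emeasure N (space N) = (\<integral>\<^sup>+x. ennreal (norm (f x)) \<partial>M)"
      unfolding N_def using f(1) f(2)[THEN less_imp_le]
      by (subst emeasure_density) (auto intro!: nn_integral_cong)
    then show "emeasure N (space N) \<noteq> \<infinity>"
      using f(3) by (simp add: integrable_iff_bounded less_top[symmetric])
  qed
  interpret N: measured_metric N U d
  proof
    show "U \<in> sets N"
      by (simp add: U sets_N)
    show "U \<noteq> {}"
      using U(2) nonzero by auto
    show "(\<lambda>(x, y). d x y) \<in> borel_measurable (N \<Otimes>\<^sub>M N)"
      using meas measurable_cong_sets[OF sets_pair_measure_cong[OF sets_N sets_N] refl] by blast
    show "emeasure N {x} = 0" if "x \<in> U" for x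
      using that U_space null_N emeasure_singleton singleton_sets by (metis subsetD)
    show "0 < emeasure N {y \<in> U. d x y < e}" if "x \<in> U" "0 < e" for x e
    proof -
      have "(\<lambda>y. (x, y)) \<in> M \<rightarrow>\<^sub>M M \<Otimes>\<^sub>M M"
        using that U_space by auto
      from measurable_compose[OF this meas] have [measurable]: "d x \<in> borel_measurable M"
        by simp
      have "{y \<in> U. d x y < e} = {y \<in> space M. d x y < e} \<inter> U"
        using U_space by auto
      also have "\<dots> \<in> sets M"
        using U(1) by measurable
      finally have "{y \<in> U. d x y < e} \<in> sets M" .
      from null_N[OF this] balls[OF that] show ?thesis
        by (simp add: zero_less_iff_neq_zero)
    qed
  qed
  obtain a :: "(nat \<Rightarrow> bool) \<Rightarrow> nat \<Rightarrow> 'a" and c :: "bool list \<Rightarrow> 'a" and K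
    where a_c: "\<And>h n. a h n = c (map h [0..<n])" and c: "\<And>s. c s \<in> U"
      and a_close: "\<And>h m n. n \<le> m \<Longrightarrow> d (a h n) (a h m) \<le> (1 / 4) ^ n"
      and a_apart: "\<And>h h'. h \<noteq> h' \<Longrightarrow> \<exists>e>0. \<exists>n. \<forall>m\<ge>n. e \<le> d (a h m) (a h' m)"
      and K: "K \<in> sets N" "emeasure N K = 0"
      and K_limit: "\<And>h x. x \<in> U \<Longrightarrow> (\<lambda>n. d (a h n) x) \<longlonglongrightarrow> 0 \<Longrightarrow> x \<in> K"
  proof (rule N.cantor_sequences, goal_cases)
    case (1 a c K)
    show ?case
      by (rule that[of a c K]) (fact 1)+
  qed
  have K_sets: "K \<in> sets M" and K_null: "emeasure M K = 0"
    using K null_N sets_N by auto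
  \<comment> \<open>Removing \<open>K\<close> alone could destroy invariance, so every point whose
    orbit ever meets \<open>K\<close> is removed. Nonsingularity keeps this a null set.\<close>
  define P where "P n = (T ^^ n) -` K \<inter> space M" for n
  have P_sets: "P n \<in> sets M" for n
    unfolding P_def using measurable_funpow K_sets by (rule measurable_sets)
  have P_null: "P n \<in> null_sets M" for n
    using P_sets emeasure_vimage_funpow[OF K_sets, of n] K_null by (auto simp: P_def)
  define U0 where "U0 = U - (\<Union>n. P n)"
  have U0_sets: "U0 \<in> sets M"
    unfolding U0_def using U(1) P_sets by blast
  have U0_sub: "U0 \<subseteq> U"
    by (auto simp: U0_def)
  have "(space M - U) \<union> (\<Union>n. P n) \<in> null_sets M"
    using U(1,2) P_null by (intro null_sets.Un null_sets_UN) auto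
  moreover have "space M - U0 = (space M - U) \<union> (\<Union>n. P n)"
    using P_sets sets.sets_into_space by (auto simp: U0_def P_def)
  ultimately have U0_null: "space M - U0 \<in> null_sets M"
    by simp
  have U0_inv: "T ` U0 \<subseteq> U0"
  proof
    fix y assume "y \<in> T ` U0"
    then obtain x where x: "x \<in> U0" "y = T x"
      by blast
    have "x \<notin> P (Suc n)" for n
      using x by (auto simp: U0_def)
    then have "y \<notin> P n" for n
      using x U0_sub U_space by (force simp: P_def funpow_swap1)
    with x U(3) U0_sub show "y \<in> U0"
      by (auto simp: U0_def)
  qed
  have U0_K: "x \<notin> K" if "x \<in> U0" for x
    using that U_space by (force simp: U0_def P_def dest: spec[of _ 0])
  \<comment> \<open>Constant sequences represent the points of \<open>U0\<close>, so that a single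
    limit formula defines \<open>d'\<close> on all pairs.\<close>
  define b where "b x n = (if x \<in> U0 then x else a (h x) n)" for x n
  have bU: "b x n \<in> U" for x n
    using U0_sub c by (auto simp: b_def a_c)
  have b_close: "d (b x n) (b x m) \<le> (1 / 4) ^ n" if "n \<le> m" for x n m
    using a_close[OF that] U0_sub by (auto simp: b_def)
  have pow_lim: "(\<lambda>n. 2 * (1 / 4 :: real) ^ n) \<longlonglongrightarrow> 0"
    by (intro tendsto_eq_intros LIMSEQ_power_zero) auto
  \<comment> \<open>Moving both endpoints changes a distance by at most the sum of the moves, here
    at most \<open>2 * (1 / 4) ^ n\<close>.\<close>
  have b_quad: "d (b x n) (b y n) \<le> d (b x m) (b y m) + (d (b x n) (b x m) + d (b y n) (b y m))" for x y n m
    using d.triangle[of "b x n" "b x m" "b y n"] d.triangle[of "b x m" "b y m" "b y n"]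
    by (simp add: bU d.commute[of "b y m" "b y n"])
  have "convergent (\<lambda>n. d (b x n) (b y n))" for x y
  proof (rule real_Cauchy_convergent, rule CauchyI')
    fix e :: real assume "0 < e"
    with pow_lim have "eventually (\<lambda>n. 2 * (1 / 4 :: real) ^ n < e) sequentially"
      by (rule order_tendstoD(2))
    then obtain k where k: "\<And>n. k \<le> n \<Longrightarrow> 2 * (1 / 4 :: real) ^ n < e"
      by (auto simp: eventually_sequentially)
    have "dist (d (b x m) (b y m)) (d (b x n) (b y n)) < e" if "k \<le> m" "m < n" for m n
      using k[OF that(1)] b_quad[of x m y n] b_quad[of x n y m] b_close[of m n x] b_close[of m n y] that(2)
      by (simp add: dist_real_def abs_if d.commute[of "b x n" "b x m"] d.commute[of "b y n" "b y m"])
    then show "\<exists>k. \<forall>m\<ge>k. \<forall>n>m. dist (d (b x m) (b y m)) (d (b x n) (b y n)) < e"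
      by blast
  qed
  define d' where "d' x y = lim (\<lambda>n. d (b x n) (b y n))" for x y
  have d'_lim: "(\<lambda>n. d (b x n) (b y n)) \<longlonglongrightarrow> d' x y" for x y
    unfolding d'_def using \<open>convergent (\<lambda>n. d (b x n) (b y n))\<close> by (simp add: convergent_LIMSEQ_iff)
  have d'_eq: "d' x y = d x y" if "x \<in> U0" "y \<in> U0" for x y
    using d'_lim[of x y] that by (simp add: b_def LIMSEQ_const_iff)
  have d'_comm: "d' x y = d' y x" for x y
    unfolding d'_def by (subst d.commute) (rule refl)
  \<comment> \<open>If \<open>y\<close> is in \<open>U0\<close>, distance 0 makes \<open>y\<close>
    the limit of a branch, hence a point of \<open>K\<close>. Otherwise the branches of
    \<open>x\<close> and \<open>y\<close> differ and stay apart.\<close>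
  have d'_ne: "d' x y \<noteq> 0" if x: "x \<in> space M" "x \<notin> U0" and y: "y \<in> space M" and xy: "x \<noteq> y" for x y
  proof
    assume "d' x y = 0"
    with d'_lim[of x y] have lim: "(\<lambda>n. d (b x n) (b y n)) \<longlonglongrightarrow> 0"
      by simp
    show False
    proof (cases "y \<in> U0")
      case True
      with lim x have "(\<lambda>n. d (a (h x) n) y) \<longlonglongrightarrow> 0"
        by (simp add: b_def)
      with True U0_sub K_limit U0_K show False
        by blast
    next
      case False
      have "h x \<noteq> h y"
        using h_inj x y xy by (auto dest: inj_onD)
      then obtain e n where "0 < e" and e: "\<forall>m\<ge>n. e \<le> d (a (h x) m) (a (h y) m)"
        using a_apart by blast
      have "e \<le> 0"
        using lim e x False by (intro LIMSEQ_le_const[OF lim]) (auto simp: b_def)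
      with \<open>0 < e\<close> show False
        by simp
    qed
  qed
  have d'_metric: "Metric_space (space M) d'"
  proof
    fix x y z
    show "0 \<le> d' x y"
      by (rule LIMSEQ_le_const[OF d'_lim]) simp
    show "d' x y = d' y x"
      by (rule d'_comm)
    show "d' x y = 0 \<longleftrightarrow> x = y" if xy: "x \<in> space M" "y \<in> space M"
    proof (cases "x = y")
      case True
      have "d' x x = 0"
        using d'_lim[of x x] bU by (simp add: LIMSEQ_const_iff)
      with True show ?thesis
        by simp
    next
      case False
      have "d' x y \<noteq> 0"
      proof (cases "x \<in> U0 \<and> y \<in> U0")
        case True
        then have "x \<in> U" "y \<in> U"
          using U0_sub by auto
        with True False show ?thesis
          by (simp add: d'_eq)
      next
        case F: False
        then show ?thesis
          using d'_ne[of x y] d'_ne[of y x] xy False d'_comm[of x y] by metis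
      qed
      with False show ?thesis
        by simp
    qed
    show "d' x z \<le> d' x y + d' y z"
      by (rule LIMSEQ_le[OF d'_lim tendsto_add[OF d'_lim d'_lim]]) (auto intro: d.triangle bU)
  qed
  have d'_le: "d' x y \<le> 1" for x y
    by (rule LIMSEQ_le_const2[OF d'_lim]) (auto intro: bounded bU)
  \<comment> \<open>Prefixes take values in the discrete space of finite lists, on which
    \<open>c\<close> is measurable for free.\<close>
  have prefix_meas: "(\<lambda>x. map (h x) [0..<n]) \<in> measurable M (count_space UNIV)" for n
  proof (induction n)
    case (Suc n)
    then have [measurable]: "(\<lambda>x. map (h x) [0..<n]) \<in> measurable M (count_space UNIV)"
      by simp
    note [measurable] = h_meas
    have "(\<lambda>x. (\<lambda>(s, b). s @ [b]) (map (h x) [0..<n], h x n)) \<in> measurable M (count_space UNIV)"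
      by measurable
    then show ?case
      by simp
  qed simp
  have b_meas: "(\<lambda>x. b x n) \<in> measurable M M" for n
  proof -
    have "c \<in> measurable (count_space UNIV) M"
      using c U_space by auto
    from measurable_compose[OF prefix_meas this] have [measurable]: "(\<lambda>x. a (h x) n) \<in> measurable M M"
      by (simp add: a_c)
    note [measurable] = U0_sets
    show ?thesis
      unfolding b_def by measurable
  qed
  have d'_meas: "(\<lambda>(x, y). d' x y) \<in> borel_measurable (M \<Otimes>\<^sub>M M)"
  proof (rule borel_measurable_LIMSEQ_real)
    fix p
    show "(\<lambda>n. (\<lambda>(x, y). d x y) (b (fst p) n, b (snd p) n)) \<longlonglongrightarrow> (\<lambda>(x, y). d' x y) p"
      using d'_lim by (simp add: split_beta)
  next
    fix n
    note [measurable] = b_meas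
    have "(\<lambda>p. (b (fst p) n, b (snd p) n)) \<in> measurable (M \<Otimes>\<^sub>M M) (M \<Otimes>\<^sub>M M)"
      by measurable
    from measurable_compose[OF this meas]
    show "(\<lambda>p. (\<lambda>(x, y). d x y) (b (fst p) n, b (snd p) n)) \<in> borel_measurable (M \<Otimes>\<^sub>M M)" .
  qed
  have d'_balls: "0 < emeasure M (dball M d' x \<epsilon>)" if x: "x \<in> space M" and \<epsilon>: "0 < \<epsilon>" for x \<epsilon>
  proof -
    have "eventually (\<lambda>n. 2 * (1 / 4 :: real) ^ n < \<epsilon>) sequentially"
      using pow_lim \<epsilon> by (rule order_tendstoD(2))
    then obtain n where n: "2 * (1 / 4 :: real) ^ n < \<epsilon>"
      by (auto simp: eventually_sequentially)
    \<comment> \<open>A representative with \<open>(1 / 4) ^ n < \<epsilon> / 2\<close> replaces the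
      centre \<open>x\<close>; up to a null set the \<open>d\<close>-ball around it lies in the
      \<open>d'\<close>-ball around \<open>x\<close>.\<close>
    have sub: "{y \<in> U. d (b x n) y < \<epsilon> / 2} - (space M - U0) \<subseteq> dball M d' x \<epsilon>"
    proof
      fix y assume "y \<in> {y \<in> U. d (b x n) y < \<epsilon> / 2} - (space M - U0)"
      then have y: "y \<in> U0" "y \<in> U" "d (b x n) y < \<epsilon> / 2"
        using U_space by auto
      have "d' x y \<le> (1 / 4) ^ n + d (b x n) y"
      proof (rule LIMSEQ_le_const2[OF d'_lim], intro exI[of _ n] allI impI)
        fix m assume "n \<le> m"
        then show "d (b x m) (b y m) \<le> (1 / 4) ^ n + d (b x n) y"
          using b_close[of n m x] d.triangle[OF bU bU y(2), of x m x n] y(1)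
          by (simp add: b_def[of y] d.commute[of "b x m" "b x n"])
      qed
      with y n U_space show "y \<in> dball M d' x \<epsilon>"
        by (auto simp: dball_def)
    qed
    have "(\<lambda>y. (x, y)) \<in> M \<rightarrow>\<^sub>M M \<Otimes>\<^sub>M M"
      using x by auto
    from measurable_compose[OF this d'_meas] have [measurable]: "d' x \<in> borel_measurable M"
      by simp
    have ball_sets: "dball M d' x \<epsilon> \<in> sets M"
      unfolding dball_def by measurable
    have "0 < emeasure M {y \<in> U. d (b x n) y < \<epsilon> / 2}"
      using \<epsilon> by (intro balls bU) auto
    also have "emeasure M {y \<in> U. d (b x n) y < \<epsilon> / 2} \<le> emeasure M (dball M d' x \<epsilon> \<union> (space M - U0))"
      using sub U0_sets ball_sets by (intro emeasure_mono sets.Un) auto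
    also have "\<dots> = emeasure M (dball M d' x \<epsilon>)"
      using ball_sets U0_null by (rule emeasure_Un_null_set)
    finally show ?thesis .
  qed
  show ?thesis
  proof (rule that[OF U0_sets U0_sub _ U0_inv])
    show "emeasure M (space M - U0) = 0"
      using U0_null by auto
    show "compatible_metric M d'"
      unfolding compatible_metric_def using d'_metric d'_le d'_meas d'_balls by auto
  qed (rule d'_eq)
qed

section \<open>Limsup bounds on sets of positive measure, and the identity isomorphism\<close>

text \<open>If all these sets were null, almost every \<open>y\<close> would have
  \<open>f n y > r\<close> infinitely often, hence limsup at least \<open>r\<close>. The gap between
  \<delta> and \<open>r\<close> is needed because a limsup of at most \<delta> bounds the tail only
  by larger constants.\<close>

lemma eventually_bounded_positive:
  assumes nAE: "\<not> (AE y in M. limsup (\<lambda>n. ereal (f n y)) > ereal \<delta>)"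
    and meas [measurable]: "\<And>n. f n \<in> borel_measurable M" and r: "\<delta> < r"
  obtains N where "0 < emeasure M {y \<in> space M. \<forall>n\<ge>N. f n y \<le> r}"
proof (rule ccontr)
  assume "\<not> thesis"
  then have "emeasure M {y \<in> space M. \<forall>n\<ge>N. f n y \<le> r} = 0" for N
    using that[of N] by (auto simp: zero_less_iff_neq_zero)
  moreover have "{y \<in> space M. \<forall>n\<ge>N. f n y \<le> r} \<in> sets M" for N
    by measurable
  ultimately have "AE y in M. y \<notin> {y \<in> space M. \<forall>n\<ge>N. f n y \<le> r}" for N
    by (intro AE_not_in null_setsI)
  then have "AE y in M. \<forall>N. y \<notin> {y \<in> space M. \<forall>n\<ge>N. f n y \<le> r}"
    by (intro AE_all_countable[THEN iffD2] allI)
  then have "AE y in M. limsup (\<lambda>n. ereal (f n y)) > ereal \<delta>"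
    using AE_space
  proof eventually_elim
    case (elim y)
    have "ereal r \<le> limsup (\<lambda>n. ereal (f n y))"
      unfolding limsup_INF_SUP
    proof (intro INF_greatest)
      fix N
      obtain n where "N \<le> n" "r < f n y"
        using elim by (auto simp: not_le)
      then show "ereal r \<le> (SUP n\<in>{N..}. ereal (f n y))"
        by (intro SUP_upper2[of n]) auto
    qed
    with r show ?case
      by (meson ereal_less_eq(3) less_ereal.simps(1) order_less_le_trans)
  qed
  with nAE show False
    by blast
qed

text \<open>This allows measurable sensitivity to be applied to the system itself, with a new
  metric.\<close>

lemma isomorphic_mod0_refl: "isomorphic_mod0 M T M T"
proof -
  have "the_inv_into (space M) id \<in> measurable M M \<longleftrightarrow> id \<in> measurable M M"
    by (intro measurable_cong) (metis id_apply inj_on_id the_inv_into_f_f)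
  then have inv: "the_inv_into (space M) id \<in> measurable M M"
    by (simp add: id_def)
  show ?thesis
    unfolding isomorphic_mod0_def
    using measurable_space[OF measurable_T] inv
    by (intro bexI[of _ "space M"] exI[of _ id])
      (auto simp: id_def bij_betw_id[unfolded id_def] intro!: measurable_restrict_space1 measurable_restrict_space2
        dest: measurable_space)
qed

section \<open>W-measurable sensitivity implies measurable sensitivity\<close>

lemma W_measurably_sensitive_imp_measurably_sensitive:
  assumes W: "W_measurably_sensitive M T"
  shows "measurably_sensitive TYPE('b) M T"
  unfolding measurably_sensitive_def
proof (intro allI impI, elim conjE)
  fix M1 :: "'b measure" and T1 d
  assume sys1: "nonsingular_system M1 T1" and iso: "isomorphic_mod0 M T M1 T1"
    and d: "compatible_metric M1 d"
  interpret S1: nonsingular_system M1 T1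
    by (rule sys1)
  interpret d: Metric_space "space M1" d
    using d by (simp add: compatible_metric_def)
  have d_le: "d x y \<le> 1" if "x \<in> space M1" "y \<in> space M1" for x y
    using d that by (simp add: compatible_metric_def)
  have d_meas: "(\<lambda>(x, y). d x y) \<in> borel_measurable (M1 \<Otimes>\<^sub>M M1)"
    using d by (simp add: compatible_metric_def)
  have d_balls: "0 < emeasure M1 (dball M1 d x \<epsilon>)" if "x \<in> space M1" "0 < \<epsilon>" for x \<epsilon>
    using d that by (simp add: compatible_metric_def)
  have d_from: "d x \<in> borel_measurable M1" if "x \<in> space M1" for x
  proof -
    have "(\<lambda>y. (x, y)) \<in> M1 \<rightarrow>\<^sub>M M1 \<Otimes>\<^sub>M M1"
      using that by simp
    from measurable_compose[OF this d_meas] show ?thesis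
      by simp
  qed
  have dball_sets: "dball M1 d x \<epsilon> \<in> sets M1" if "x \<in> space M1" for x \<epsilon>
    unfolding dball_def using d_from[OF that] by measurable
  obtain U U' \<phi> where U: "U \<in> sets M" "emeasure M (space M - U) = 0" "T ` U \<subseteq> U"
    and U': "U' \<in> sets M1" "emeasure M1 (space M1 - U') = 0"
    and bij: "bij_betw \<phi> U U'"
    and \<phi>_meas: "\<phi> \<in> measurable (restrict_space M U) (restrict_space M1 U')"
    and \<phi>_pres: "\<And>A. A \<in> sets M \<Longrightarrow> A \<subseteq> U \<Longrightarrow> emeasure M1 (\<phi> ` A) = emeasure M A"
    and \<phi>_T: "\<And>x. x \<in> U \<Longrightarrow> \<phi> (T x) = T1 (\<phi> x)"
    using iso unfolding isomorphic_mod0_def by metis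
  have U_space: "U \<subseteq> space M" and U'_space: "U' \<subseteq> space M1"
    using U(1) U'(1) by (auto dest: sets.sets_into_space)
  obtain c where c: "c \<in> space M1"
    using S1.nonzero by fastforce
  \<comment> \<open>The default value \<open>c\<close> makes \<psi> measurable on the whole space,
    and with it the pulled-back distance \<open>e\<close>. On \<open>U\<close> nothing changes, and
    there \<open>e\<close> is a metric.\<close>
  define \<psi> where "\<psi> x = (if x \<in> U then \<phi> x else c)" for x
  have \<psi>_meas: "\<psi> \<in> measurable M M1"
  proof -
    have "\<phi> \<in> measurable (restrict_space M U) M1"
      using \<phi>_meas by (simp add: measurable_restrict_space2_iff)
    moreover have "{x \<in> space M. x \<in> U} = U"
      using U_space by auto
    ultimately show ?thesis
      unfolding \<psi>_def using U(1) c by (subst measurable_If_restrict_space_iff) auto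
  qed
  have \<psi>_space: "\<psi> x \<in> space M1" for x
    using bij U'_space c by (auto simp: \<psi>_def bij_betw_def)
  have pull_sets: "{y \<in> U. \<psi> y \<in> B} \<in> sets M" if "B \<in> sets M1" for B
  proof -
    have "{y \<in> U. \<psi> y \<in> B} = U \<inter> (\<psi> -` B \<inter> space M)"
      using U_space by auto
    also have "\<dots> \<in> sets M"
      using U(1) measurable_sets[OF \<psi>_meas that] by blast
    finally show ?thesis .
  qed
  have pull: "emeasure M {y \<in> U. \<psi> y \<in> B} = emeasure M1 B" if "B \<in> sets M1" for B
  proof -
    have "emeasure M {y \<in> U. \<psi> y \<in> B} = emeasure M1 (\<phi> ` {y \<in> U. \<psi> y \<in> B})"
      using pull_sets[OF that] by (intro \<phi>_pres[symmetric]) auto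
    \<comment> \<open>The image misses only the points of \<open>B\<close> outside
      \<open>U'\<close>, a null set.\<close>
    also have "\<phi> ` {y \<in> U. \<psi> y \<in> B} = B - (space M1 - U')"
      using bij sets.sets_into_space[OF that] by (force simp: \<psi>_def bij_betw_def)
    also have "emeasure M1 \<dots> = emeasure M1 B"
      using U' that by (intro emeasure_Diff_null_set) auto
    finally show ?thesis .
  qed
  define e where "e x y = d (\<psi> x) (\<psi> y)" for x y
  have e_metric: "Metric_space U e"
  proof
    fix x y z
    show "0 \<le> e x y" "e x y = e y x"
      by (simp_all add: e_def d.commute)
    show "e x y = 0 \<longleftrightarrow> x = y" if "x \<in> U" "y \<in> U"
      using that bij \<psi>_space[of x] \<psi>_space[of y]
      by (auto simp: e_def \<psi>_def bij_betw_def dest: inj_onD)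
    show "e x z \<le> e x y + e y z"
      unfolding e_def by (intro d.triangle \<psi>_space)
  qed
  have e_meas: "(\<lambda>(x, y). e x y) \<in> borel_measurable (M \<Otimes>\<^sub>M M)"
  proof -
    note [measurable] = \<psi>_meas
    have "(\<lambda>p. (\<psi> (fst p), \<psi> (snd p))) \<in> measurable (M \<Otimes>\<^sub>M M) (M1 \<Otimes>\<^sub>M M1)"
      by measurable
    from measurable_compose[OF this d_meas] show ?thesis
      by (simp add: e_def split_beta)
  qed
  have e_balls: "0 < emeasure M {y \<in> U. e x y < r}" if "x \<in> U" "0 < r" for x r
  proof -
    have "{y \<in> U. e x y < r} = {y \<in> U. \<psi> y \<in> dball M1 d (\<psi> x) r}"
      by (auto simp: e_def dball_def \<psi>_space)
    then show ?thesis
      using pull[OF dball_sets] d_balls that \<psi>_space by simp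
  qed
  obtain U0 d' where U0: "U0 \<in> sets M" "U0 \<subseteq> U" "emeasure M (space M - U0) = 0" "T ` U0 \<subseteq> U0"
    and d': "compatible_metric M d'" and d'_e: "\<And>x y. x \<in> U0 \<Longrightarrow> y \<in> U0 \<Longrightarrow> d' x y = e x y"
  proof (rule extend_metric[OF U e_metric _ e_meas e_balls])
    show "e x y \<le> 1" for x y
      unfolding e_def by (intro d_le \<psi>_space)
  qed (assumption, assumption, rule that)
  have orbit: "(T ^^ n) x \<in> U0 \<and> \<psi> ((T ^^ n) x) = (T1 ^^ n) (\<psi> x)" if "x \<in> U0" for n x
  proof (induction n)
    case (Suc n)
    then have "(T ^^ n) x \<in> U" "T ((T ^^ n) x) \<in> U" "T ((T ^^ n) x) \<in> U0"
      using U0(2,4) U(3) by auto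
    with Suc \<phi>_T show ?case
      by (simp add: \<psi>_def split: if_splits)
  qed (use that in simp)
  obtain \<delta> where \<delta>: "0 < \<delta>"
    and sens: "\<And>x. x \<in> space M \<Longrightarrow>
      AE y in M. limsup (\<lambda>n. ereal (d' ((T ^^ n) x) ((T ^^ n) y))) > ereal \<delta>"
    using W d' unfolding W_measurably_sensitive_def W_sensitive_wrt_def by blast
  have "\<exists>n. 0 < emeasure M1 {y \<in> dball M1 d x \<epsilon>. d ((T1 ^^ n) x) ((T1 ^^ n) y) > \<delta> / 2}"
    if x: "x \<in> space M1" and \<epsilon>: "0 < \<epsilon>" for x \<epsilon>
  proof (rule ccontr)
    \<comment> \<open>Failure of sensitivity makes all these sets null, so almost every point of the
      ball stays within \<open>\<delta> / 2\<close> of \<open>x\<close> at all times.\<close>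
    define E where "E n = {y \<in> dball M1 d x \<epsilon>. d ((T1 ^^ n) x) ((T1 ^^ n) y) > \<delta> / 2}" for n
    assume "\<not> ?thesis"
    then have E_null: "emeasure M1 (E n) = 0" for n
      by (simp add: E_def)
    have T1_space: "(T1 ^^ n) y \<in> space M1" if "y \<in> space M1" for n y
      using measurable_space[OF S1.measurable_funpow that] .
    have E_sets: "E n \<in> sets M1" for n
    proof -
      note [measurable] = S1.measurable_funpow[of n] d_from[OF T1_space[OF x, of n]] dball_sets[OF x, of \<epsilon>]
      have "E n = dball M1 d x \<epsilon> \<inter> {y \<in> space M1. d ((T1 ^^ n) x) ((T1 ^^ n) y) > \<delta> / 2}"
        by (auto simp: E_def dball_def)
      also have "\<dots> \<in> sets M1"
        by measurable
      finally show ?thesis .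
    qed
    have "AE y in M. y \<notin> {y \<in> U. \<psi> y \<in> E n}" for n
      using pull[OF E_sets] E_null pull_sets[OF E_sets] by (intro AE_not_in) auto
    then have "AE y in M. \<forall>n. y \<notin> {y \<in> U. \<psi> y \<in> E n}"
      by (intro AE_all_countable[THEN iffD2] allI)
    moreover have "AE y in M. y \<notin> space M - U0"
      using U0(1,3) by (intro AE_not_in) auto
    ultimately have good: "AE y in M. y \<in> U0 \<and> (\<forall>n. \<psi> y \<notin> E n)"
      using AE_space by eventually_elim (use U0(2) in auto)
    define B where "B = {y \<in> U. \<psi> y \<in> dball M1 d x \<epsilon>}"
    have B: "B \<in> sets M" "0 < emeasure M B"
      unfolding B_def using pull_sets pull d_balls dball_sets x \<epsilon> by auto
    have B_pos: "\<not> (AE y in M. y \<notin> B)"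
      using B by (simp add: AE_iff_null_sets[symmetric] null_sets_def)
    have near: "d ((T1 ^^ n) x) ((T1 ^^ n) (\<psi> y)) \<le> \<delta> / 2" if "y \<in> B" "\<forall>n. \<psi> y \<notin> E n" for y n
      using that by (auto simp: B_def E_def not_less)
    \<comment> \<open>The point \<open>x\<close> may lie outside \<open>U'\<close> and have no
      counterpart in \<open>M\<close>. A point \<open>w\<close> whose image shadows the orbit of
      \<open>x\<close> replaces it, at the price of doubling \<open>\<delta> / 2\<close>.\<close>
    have "\<exists>w\<in>B. w \<in> U0 \<and> (\<forall>n. \<psi> w \<notin> E n)"
    proof (rule ccontr)
      assume none: "\<not> ?thesis"
      from good have "AE y in M. y \<notin> B"
        by eventually_elim (use none in blast)
      with B_pos show False
        by blast
    qed
    then obtain w where w: "w \<in> B" "w \<in> U0" "\<forall>n. \<psi> w \<notin> E n"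
      by blast
    have "w \<in> space M"
      using w(2) U0(2) U_space by blast
    from good sens[OF this] have "AE y in M. y \<notin> B"
    proof eventually_elim
      case (elim y)
      show "y \<notin> B"
      proof
        assume y: "y \<in> B"
        have "d' ((T ^^ n) w) ((T ^^ n) y) \<le> \<delta>" for n
        proof -
          have "d' ((T ^^ n) w) ((T ^^ n) y) = d ((T1 ^^ n) (\<psi> w)) ((T1 ^^ n) (\<psi> y))"
            using orbit[OF w(2), of n] orbit[of y n] elim(1) by (simp add: d'_e e_def)
          also have "\<dots> \<le> d ((T1 ^^ n) (\<psi> w)) ((T1 ^^ n) x) + d ((T1 ^^ n) x) ((T1 ^^ n) (\<psi> y))"
            by (intro d.triangle T1_space \<psi>_space x)
          also have "\<dots> \<le> \<delta> / 2 + \<delta> / 2"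
            using near[OF w(1,3), of n] near[OF y conjunct2[OF elim(1)], of n]
            by (intro add_mono) (simp_all add: d.commute[of _ "(T1 ^^ n) x"])
          finally show ?thesis
            by simp
        qed
        then have "limsup (\<lambda>n. ereal (d' ((T ^^ n) w) ((T ^^ n) y))) \<le> ereal \<delta>"
          by (intro Limsup_bounded) simp
        with elim(2) show False
          by simp
      qed
    qed
    with B_pos show False
      by blast
  qed
  then show "\<exists>\<delta>>0. \<forall>x\<in>space M1. \<forall>\<epsilon>>0. \<exists>n.
      0 < emeasure M1 {y \<in> dball M1 d x \<epsilon>. d ((T1 ^^ n) x) ((T1 ^^ n) y) > \<delta>}"
    using \<delta> by (intro exI[of _ "\<delta> / 2"]) auto
qed

section \<open>The converse for conservative ergodic systems\<close>

lemma conservative_ergodic_measurably_sensitive_imp_W: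
  assumes erg: "conservative_ergodic M T" and sens: "measurably_sensitive TYPE('a) M T"
  shows "W_measurably_sensitive M T"
  unfolding W_measurably_sensitive_def
proof (intro allI impI, rule ccontr)
  fix d
  assume d: "compatible_metric M d" and not_W: "\<not> W_sensitive_wrt M T d"
  interpret d: Metric_space "space M" d
    using d by (simp add: compatible_metric_def)
  have d_le: "d x y \<le> 1" if "x \<in> space M" "y \<in> space M" for x y
    using d that by (simp add: compatible_metric_def)
  have d_meas: "(\<lambda>(x, y). d x y) \<in> borel_measurable (M \<Otimes>\<^sub>M M)"
    using d by (simp add: compatible_metric_def)
  have T_space: "(T ^^ n) x \<in> space M" if "x \<in> space M" for n x
    using measurable_space[OF measurable_funpow that] .
  define g where "g n x y = d ((T ^^ n) x) ((T ^^ n) y)" for n x y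
  have g_meas: "(\<lambda>p. g n (fst p) (snd p)) \<in> borel_measurable (M \<Otimes>\<^sub>M M)" for n
  proof -
    note [measurable] = measurable_funpow[of n]
    have "(\<lambda>p. ((T ^^ n) (fst p), (T ^^ n) (snd p))) \<in> measurable (M \<Otimes>\<^sub>M M) (M \<Otimes>\<^sub>M M)"
      by measurable
    from measurable_compose[OF this d_meas] show ?thesis
      by (simp add: g_def)
  qed
  have g_le: "g n x y \<le> 1" if "x \<in> space M" "y \<in> space M" for n x y
    unfolding g_def by (intro d_le T_space that)
  have g_bdd: "bdd_above (range (\<lambda>n. g n x y))" if "x \<in> space M" "y \<in> space M" for x y
    using g_le[OF that] by (intro bdd_aboveI2)

  text \<open>The least metric above \<open>d\<close> for which \<open>T\<close> is 1-Lipschitz; the value \<open>0\<close> off the space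
    avoids suprema of unbounded sets.\<close>
  define D where "D x y = (if x \<in> space M \<and> y \<in> space M then SUP n. g n x y else 0)" for x y
  have g_D: "g n x y \<le> D x y" if "x \<in> space M" "y \<in> space M" for n x y
    using g_bdd[OF that] that by (auto simp: D_def intro!: cSUP_upper)
  have D_least: "D x y \<le> r" if "x \<in> space M" "y \<in> space M" "\<And>n. g n x y \<le> r" for x y r
    using that by (auto simp: D_def intro!: cSUP_least)
  have D_T: "D (T x) (T y) \<le> D x y" if "x \<in> space M" "y \<in> space M" for x y
  proof (rule D_least)
    show "g n (T x) (T y) \<le> D x y" for n
      using g_D[OF that, of "Suc n"] by (simp add: g_def funpow_swap1)
  qed (use that T_space[of _ 1] in auto)
  have D_funpow: "D ((T ^^ n) x) ((T ^^ n) y) \<le> D x y" if "x \<in> space M" "y \<in> space M" for n x y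
  proof (induction n)
    case (Suc n)
    then show ?case
      using D_T[OF T_space[OF that(1)] T_space[OF that(2)], of n n] by simp
  qed simp
  have D_metric: "Metric_space (space M) D"
  proof
    fix x y z
    show "0 \<le> D x y"
    proof (cases "x \<in> space M \<and> y \<in> space M")
      case True
      then show ?thesis
        using g_D[of x y 0] d.nonneg[of x y] by (simp add: g_def) (metis d.nonneg order_trans)
    qed (auto simp: D_def)
    show "D x y = D y x"
      by (auto simp: D_def g_def d.commute)
    show "D x y = 0 \<longleftrightarrow> x = y" if xy: "x \<in> space M" "y \<in> space M"
    proof
      assume "D x y = 0"
      then have "d x y \<le> 0"
        using g_D[OF xy, of 0] by (simp add: g_def)
      then have "d x y = 0"
        by (intro antisym) simp_all
      with xy show "x = y"
        by simp
    next
      assume "x = y"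
      then show "D x y = 0"
        using xy T_space by (simp add: D_def g_def)
    qed
    show "D x z \<le> D x y + D y z" if "x \<in> space M" "y \<in> space M" "z \<in> space M"
    proof (rule D_least)
      fix n
      have "g n x z \<le> g n x y + g n y z"
        unfolding g_def by (intro d.triangle T_space that)
      also have "\<dots> \<le> D x y + D y z"
        by (intro add_mono g_D that)
      finally show "g n x z \<le> D x y + D y z" .
    qed (use that in auto)
  qed
  interpret D: Metric_space "space M" D
    by (rule D_metric)
  have D_meas: "(\<lambda>(x, y). D x y) \<in> borel_measurable (M \<Otimes>\<^sub>M M)"
  proof -
    have "(\<lambda>p. SUP n. g n (fst p) (snd p)) \<in> borel_measurable (M \<Otimes>\<^sub>M M)"
      using g_meas g_bdd by (intro borel_measurable_cSUP) (auto simp: space_pair_measure)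
    then show ?thesis
      by (rule measurable_cong[THEN iffD1, rotated]) (auto simp: D_def space_pair_measure)
  qed
  have D_from: "D x \<in> borel_measurable M" if "x \<in> space M" for x
  proof -
    have "(\<lambda>y. (x, y)) \<in> M \<rightarrow>\<^sub>M M \<Otimes>\<^sub>M M"
      using that by simp
    from measurable_compose[OF this D_meas] show ?thesis
      by simp
  qed
  have ball_sets: "dball M D x r \<in> sets M" if "x \<in> space M" for x r
    unfolding dball_def using D_from[OF that] by measurable

  define A where "A r = {x \<in> space M. 0 < emeasure M (dball M D x r)}" for r
  have A_sets: "A r \<in> sets M" for r
  proof -
    \<comment> \<open>The \<open>D\<close>-balls are the sections of this product set, so their
      measures depend measurably on the centre.\<close>
    have "{p \<in> space (M \<Otimes>\<^sub>M M). (\<lambda>(x, y). D x y) p < r} \<in> sets (M \<Otimes>\<^sub>M M)"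
      using D_meas by measurable
    from measurable_emeasure_Pair[OF this]
    have [measurable]: "(\<lambda>x. emeasure M (Pair x -` {p \<in> space (M \<Otimes>\<^sub>M M). (\<lambda>(x, y). D x y) p < r})) \<in> borel_measurable M" .
    have "A r = {x \<in> space M. 0 < emeasure M (Pair x -` {p \<in> space (M \<Otimes>\<^sub>M M). (\<lambda>(x, y). D x y) p < r})}"
      unfolding A_def dball_def
      by (intro Collect_cong conj_cong refl arg_cong[where f = "\<lambda>S. 0 < emeasure M S"])
        (auto simp: space_pair_measure)
    also have "\<dots> \<in> sets M"
      by measurable
    finally show ?thesis .
  qed
  \<comment> \<open>Failure with constant \<open>r / 4\<close> gives a point \<open>x\<close> and a
    positive set of \<open>y\<close> whose orbits stay within \<open>r / 2\<close> of that of
    \<open>x\<close> from time \<open>N\<close> on. This set lies in the preimage of the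
    \<open>D\<close>-ball around \<open>(T ^^ N) x\<close>, which is positive by nonsingularity. The
    step from \<open>r / 4\<close> to \<open>r / 2\<close> absorbs the limsup, the one to
    \<open>r\<close> the strict inequality.\<close>
  have A_nonempty: "\<exists>x. x \<in> A r" if r: "0 < r" for r
  proof -
    have "0 < r / 4"
      using r by simp
    with not_W obtain x where x: "x \<in> space M"
      and "\<not> (AE y in M. limsup (\<lambda>n. ereal (g n x y)) > ereal (r / 4))"
      unfolding W_sensitive_wrt_def g_def by blast
    moreover have "(\<lambda>y. g n x y) \<in> borel_measurable M" for n
    proof -
      have "(\<lambda>y. (x, y)) \<in> M \<rightarrow>\<^sub>M M \<Otimes>\<^sub>M M"
        using x by simp
      from measurable_compose[OF this g_meas] show ?thesis
        by simp
    qed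
    ultimately obtain N where N: "0 < emeasure M {y \<in> space M. \<forall>n\<ge>N. g n x y \<le> r / 2}"
      using eventually_bounded_positive[of "r / 4" "\<lambda>n. g n x" "r / 2"] r by auto
    have "{y \<in> space M. \<forall>n\<ge>N. g n x y \<le> r / 2} \<subseteq> (T ^^ N) -` dball M D ((T ^^ N) x) r \<inter> space M"
    proof
      fix y assume y: "y \<in> {y \<in> space M. \<forall>n\<ge>N. g n x y \<le> r / 2}"
      have "D ((T ^^ N) x) ((T ^^ N) y) \<le> r / 2"
      proof (rule D_least)
        show "g n ((T ^^ N) x) ((T ^^ N) y) \<le> r / 2" for n
          using y by (simp add: g_def funpow_add[symmetric] flip: comp_apply[of "T ^^ n" "T ^^ N"])
      qed (use x y T_space in auto)
      with r y T_space show "y \<in> (T ^^ N) -` dball M D ((T ^^ N) x) r \<inter> space M"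
        by (auto simp: dball_def)
    qed
    then have "emeasure M {y \<in> space M. \<forall>n\<ge>N. g n x y \<le> r / 2} \<le>
        emeasure M ((T ^^ N) -` dball M D ((T ^^ N) x) r \<inter> space M)"
      by (intro emeasure_mono measurable_sets[OF measurable_funpow] ball_sets T_space x)
    with N have "emeasure M ((T ^^ N) -` dball M D ((T ^^ N) x) r \<inter> space M) \<noteq> 0"
      by auto
    then have "0 < emeasure M (dball M D ((T ^^ N) x) r)"
      using emeasure_vimage_funpow[OF ball_sets[OF T_space[OF x]]] by (simp add: zero_less_iff_neq_zero)
    with x T_space show ?thesis
      by (auto simp: A_def)
  qed
  have A_T: "T x \<in> A r" if "x \<in> A r" for x r
  proof (rule ccontr)
    assume "T x \<notin> A r"
    have x: "x \<in> space M" "T x \<in> space M"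
      using that T_space[of x 1] by (auto simp: A_def)
    have "dball M D x r \<subseteq> T -` dball M D (T x) r \<inter> space M"
      using x T_space[of _ 1] D_T by (force simp: dball_def)
    then have "emeasure M (dball M D x r) \<le> emeasure M (T -` dball M D (T x) r \<inter> space M)"
      by (intro emeasure_mono measurable_sets[OF measurable_T] ball_sets x)
    also have "\<dots> = 0"
      using nonsingular[OF ball_sets[OF x(2)]] \<open>T x \<notin> A r\<close> x by (auto simp: A_def)
    finally show False
      using that by (simp add: A_def)
  qed
  have A_conull: "emeasure M (space M - A r) = 0" if r: "0 < r" for r
  proof -
    obtain x where x: "x \<in> space M" "0 < emeasure M (dball M D x (r / 2))"
      using A_nonempty[of "r / 2"] r by (auto simp: A_def)
    \<comment> \<open>A single point of \<open>A (r / 2)\<close> thus contributes a whole ball of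
      positive measure to \<open>A r\<close>.\<close>
    have "dball M D x (r / 2) \<subseteq> A r"
    proof
      fix y assume "y \<in> dball M D x (r / 2)"
      then have y: "y \<in> space M" "D x y < r / 2"
        by (auto simp: dball_def)
      have "dball M D x (r / 2) \<subseteq> dball M D y r"
      proof
        fix z assume "z \<in> dball M D x (r / 2)"
        then show "z \<in> dball M D y r"
          using y D.triangle[OF y(1) x(1), of z] by (auto simp: dball_def D.commute[of y x])
      qed
      then have "emeasure M (dball M D x (r / 2)) \<le> emeasure M (dball M D y r)"
        using y(1) by (intro emeasure_mono ball_sets)
      with x(2) y(1) show "y \<in> A r"
        by (auto simp: A_def)
    qed
    then have "emeasure M (dball M D x (r / 2)) \<le> emeasure M (A r)"
      using A_sets by (intro emeasure_mono)
    with x(2) have A_pos: "emeasure M (A r) \<noteq> 0"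
      by auto
    \<comment> \<open>Since \<open>A r\<close> is forward invariant, its complement contains its own
      preimage, as the ergodicity hypothesis requires.\<close>
    have "T -` (space M - A r) \<inter> space M \<subseteq> space M - A r"
      using A_T by blast
    moreover have "space M - (space M - A r) = A r"
      using sets.sets_into_space[OF A_sets] by blast
    moreover have "space M - A r \<in> sets M"
      using A_sets by blast
    ultimately show ?thesis
      using erg A_pos unfolding conservative_ergodic_def by metis
  qed
  \<comment> \<open>Countably many radii suffice, which keeps \<open>U\<close> measurable and
    conull.\<close>
  define U where "U = (\<Inter>k. A (1 / Suc k))"
  have U_sets: "U \<in> sets M"
    unfolding U_def using A_sets by blast
  have U_space: "U \<subseteq> space M"
    using U_sets by (rule sets.sets_into_space)
  have "(\<Union>k. space M - A (1 / Suc k)) \<in> null_sets M"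
    using A_conull A_sets by (intro null_sets_UN) auto
  moreover have "space M - U = (\<Union>k. space M - A (1 / Suc k))"
    by (auto simp: U_def)
  ultimately have U_null: "space M - U \<in> null_sets M"
    by simp
  have U_T: "T ` U \<subseteq> U"
    using A_T by (auto simp: U_def)
  have D_le: "D x y \<le> 1" if "x \<in> U" "y \<in> U" for x y
    using that U_space by (intro D_least g_le) auto
  have U_balls: "0 < emeasure M {y \<in> U. D x y < r}" if x: "x \<in> U" and r: "0 < r" for x r
  proof -
    obtain k where k: "1 / real (Suc k) < r"
      using r by (metis nat_approx_posE)
    have xs: "x \<in> space M"
      using x U_space by blast
    have "0 < emeasure M (dball M D x (1 / Suc k))"
      using x by (auto simp: U_def A_def)
    also have "\<dots> \<le> emeasure M (dball M D x r)"
      using k by (intro emeasure_mono ball_sets xs) (auto simp: dball_def)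
    also have "\<dots> = emeasure M (dball M D x r - (space M - U))"
      using U_null ball_sets[OF xs] by (simp add: emeasure_Diff_null_set)
    also have "dball M D x r - (space M - U) = {y \<in> U. D x y < r}"
      using U_space by (auto simp: dball_def)
    finally show ?thesis .
  qed
  have U_metric: "Metric_space U D"
    by (rule D.subspace) (rule U_space)
  obtain U0 d' where U0: "U0 \<in> sets M" "U0 \<subseteq> U" "emeasure M (space M - U0) = 0" "T ` U0 \<subseteq> U0"
    and d': "compatible_metric M d'" and d'_D: "\<And>x y. x \<in> U0 \<Longrightarrow> y \<in> U0 \<Longrightarrow> d' x y = D x y"
  proof (rule extend_metric[OF U_sets _ U_T U_metric D_le D_meas U_balls])
    show "emeasure M (space M - U) = 0"
      using U_null by auto
  qed (assumption, assumption, assumption, assumption, rule that)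
  have orbit: "(T ^^ n) x \<in> U0" if "x \<in> U0" for n x
    using that U0(4) by (induction n) auto
  have "nonsingular_system M T"
    by unfold_locales
  with sens d' isomorphic_mod0_refl obtain \<delta> where \<delta>: "0 < \<delta>"
    and sens': "\<And>x \<epsilon>. x \<in> space M \<Longrightarrow> 0 < \<epsilon> \<Longrightarrow>
      \<exists>n. 0 < emeasure M {y \<in> dball M d' x \<epsilon>. d' ((T ^^ n) x) ((T ^^ n) y) > \<delta>}"
    unfolding measurably_sensitive_def by blast
  obtain x where x: "x \<in> U0"
    using U0(3) nonzero by fastforce
  have xs: "x \<in> space M"
    using x U0(2) U_space by blast
  \<comment> \<open>The radius is taken equal to the sensitivity constant: on \<open>U0\<close> the
    iterates do not increase \<open>d'\<close>, so points starting within \<delta> of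
    \<open>x\<close> never get farther than \<delta>. Only the null complement of \<open>U0\<close>
    remains.\<close>
  obtain n where n: "0 < emeasure M {y \<in> dball M d' x \<delta>. d' ((T ^^ n) x) ((T ^^ n) y) > \<delta>}"
    using sens'[OF xs \<delta>] by blast
  have "{y \<in> dball M d' x \<delta>. d' ((T ^^ n) x) ((T ^^ n) y) > \<delta>} \<subseteq> space M - U0"
  proof
    fix y assume y: "y \<in> {y \<in> dball M d' x \<delta>. d' ((T ^^ n) x) ((T ^^ n) y) > \<delta>}"
    have "y \<notin> U0"
    proof
      assume "y \<in> U0"
      then have "d' ((T ^^ n) x) ((T ^^ n) y) \<le> d' x y"
        using x orbit D_funpow[of x y n] U0(2) U_space by (auto simp: d'_D)
      with y show False
        by (simp add: dball_def)
    qed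
    with y show "y \<in> space M - U0"
      by (simp add: dball_def)
  qed
  then have "emeasure M {y \<in> dball M d' x \<delta>. d' ((T ^^ n) x) ((T ^^ n) y) > \<delta>} \<le> emeasure M (space M - U0)"
    using U0(1) by (intro emeasure_mono) auto
  with n U0(3) show False
    by simp
qed

end

theorem proposition7p2:
  fixes M :: "'a measure" and T :: "'a \<Rightarrow> 'a"
  assumes "nonsingular_system M T"
  shows "(W_measurably_sensitive M T \<longrightarrow> measurably_sensitive TYPE('b) M T) \<and>
         (conservative_ergodic M T \<and> measurably_sensitive TYPE('a) M T \<longrightarrow>
            W_measurably_sensitive M T)"
  using nonsingular_system.W_measurably_sensitive_imp_measurably_sensitive[OF assms]
    nonsingular_system.conservative_ergodic_measurably_sensitive_imp_W[OF assms]
  by blast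

end
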